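(* Let $2D$ be the distance between the odd prime numbers $p_i<p_f$ of a pair belonging to class I, II or III, with running variable $a$. Then: \begin{itemize} \item For class III, $D\equiv 0\pmod 6$ and $p_i\equiv p_f\equiv 2a+1\pmod 6$. If $a\equiv 0\pmod 3$, then $p_i\equiv p_f\equiv 1\pmod 6$. If $a\equiv -1\pmod 3$, then $p_i\equiv p_f\equiv -1\pmod 6$. \item For class II with $D\equiv 2r\pmod 6$: $r=\pm1$ yields $p_i\equiv \pm 1\pmod 6$, $p_f\equiv \mp 1\pmod 6$; and $r=\pm 2$ gives $p_i\equiv \mp 1\pmod 6$, $p_f\equiv \pm1\pmod 6$ (upper signs together, lower signs together). \item For class I with $D\equiv 1+2r\pmod 6$, $r\in\{0,1,-1\}$, and $a\equiv a_0\pmod 3$, $a_0\in\{0,1,-1\}$, the prime pair obeys $p_i\equiv -1-2r+2a_0\pmod 6$ and $p_f\equiv 1+2r+2a_0\pmod 6$. For $r=0$ and $r=-1$, i.e. $D\equiv\pm1\pmod 6$, one has $a_0=0$. For $r=1$, i.e. $D\equiv 3\pmod 6$, one has $a\not\equiv 0\pmod 3$. \end{itemize}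
   Context: For odd primes $p_i<p_f$ with $p_f-p_i=2D$, $D$ a positive integer, the classes are, with $a$ an integer: class I: $D$ odd, $p_i=2a-D$, $p_f=2a+D$; class II: $2\mid D$, $3\nmid D$, $p_i=3(2a-1)-D$, $p_f=3(2a-1)+D$; class III: $6\mid D$, $D\ge 6$, $p_i=2a+1-D$, $p_f=2a+1+D$. The integer $a$ is called the running variable of the pair.
   Formalization: For class I with r = 0 or r = -1, the claim a_0 = 0 is proved only for p_i ≠ 3; it fails when p_i = 3, for example for the pair (3, 5) with D = 1, a = 2, a_0 = -1. *)

theory Defs
  imports "HOL-Computational_Algebra.Primes" "HOL-Number_Theory.Cong"
begin

text \<open>
  Everything is integer-valued, so that subtraction and negative residues have their usual meaning;
  \<^term>\<open>prime (p::int)\<close> forces \<^term>\<open>p\<close> to be positive.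
\<close>

definition odd_prime_pair :: "int \<Rightarrow> int \<Rightarrow> int \<Rightarrow> bool" where
  "odd_prime_pair p_i p_f D \<longleftrightarrow>
     prime p_i \<and> odd p_i \<and> prime p_f \<and> odd p_f \<and> p_i < p_f \<and> D > 0 \<and> p_f - p_i = 2 * D"

text \<open>In the three classes the argument \<^term>\<open>a\<close> is the running variable of the pair.\<close>

definition class_I :: "int \<Rightarrow> int \<Rightarrow> int \<Rightarrow> int \<Rightarrow> bool" where
  "class_I p_i p_f D a \<longleftrightarrow>
     odd_prime_pair p_i p_f D \<and> odd D \<and> p_i = 2 * a - D \<and> p_f = 2 * a + D"

definition class_II :: "int \<Rightarrow> int \<Rightarrow> int \<Rightarrow> int \<Rightarrow> bool" where
  "class_II p_i p_f D a \<longleftrightarrow>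
     odd_prime_pair p_i p_f D \<and> 2 dvd D \<and> \<not> 3 dvd D \<and>
     p_i = 3 * (2 * a - 1) - D \<and> p_f = 3 * (2 * a - 1) + D"

definition class_III :: "int \<Rightarrow> int \<Rightarrow> int \<Rightarrow> int \<Rightarrow> bool" where
  "class_III p_i p_f D a \<longleftrightarrow>
     odd_prime_pair p_i p_f D \<and> 6 dvd D \<and> D \<ge> 6 \<and>
     p_i = 2 * a + 1 - D \<and> p_f = 2 * a + 1 + D"

end

theory Submission
  imports Defs
begin

text \<open>Modulo 6 the term \<open>2 * a\<close> depends only on \<open>a\<close> modulo 3, and
  \<open>3 * (2 * a - 1)\<close> is always 3. Substituting the residue of \<open>D\<close> into the
  formulas for \<open>p_i\<close> and \<open>p_f\<close> thus gives their residues in each class.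
  The constraints on \<open>a\<close> in class I come from primality: by
  \<open>odd_prime_pair_3_dvd\<close>, 3 never divides \<open>p_f\<close>, and divides
  \<open>p_i\<close> only if \<open>p_i = 3\<close>. That case is a real exception: 3, 5 has
  \<open>D = 1\<close> and \<open>a = 2\<close>, so \<open>a0 = -1\<close>.\<close>

lemma odd_prime_pair_3_dvd:
  assumes "odd_prime_pair p_i p_f D"
  shows "3 dvd p_i \<longleftrightarrow> p_i = 3" and "\<not> 3 dvd p_f"
proof -
  have p: "prime p_i" "prime p_f" "odd p_i" "p_i < p_f"
    using assms by (auto simp: odd_prime_pair_def)
  \<comment> \<open>The smaller prime is odd, hence at least 3, so the larger one exceeds 3.\<close>
  have "p_i \<noteq> 2" "p_i \<ge> 2" using p prime_ge_2_int by auto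
  then have "p_f \<noteq> 3" using p(4) by simp
  moreover have "3 dvd p \<longleftrightarrow> p = 3" if "prime p" for p :: int
    using primes_dvd_imp_eq[of 3 p] that by auto
  ultimately show "3 dvd p_i \<longleftrightarrow> p_i = 3" and "\<not> 3 dvd p_f"
    using p(1,2) by blast+
qed

lemma class_III_residues:
  assumes "class_III p_i p_f D a"
  shows "[D = 0] (mod 6) \<and> [p_i = p_f] (mod 6) \<and> [p_f = 2 * a + 1] (mod 6) \<and>
        ([a = 0] (mod 3) \<longrightarrow> [p_i = 1] (mod 6) \<and> [p_f = 1] (mod 6)) \<and>
        ([a = -1] (mod 3) \<longrightarrow> [p_i = -1] (mod 6) \<and> [p_f = -1] (mod 6))"
proof -
  have "6 dvd D" "p_i = 2 * a + 1 - D" "p_f = 2 * a + 1 + D"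
    using assms by (auto simp: class_III_def)
  then show ?thesis unfolding cong_iff_dvd_diff by (intro conjI impI; presburger)
qed

text \<open>The sign \<open>s\<close> encodes the paired upper and lower signs. The residues are
  \<open>3 - 2 * r\<close> and \<open>3 + 2 * r\<close> modulo 6; put \<open>r = s\<close> or
  \<open>r = 2 * s\<close>.\<close>

lemma class_II_residues:
  assumes "class_II p_i p_f D a" and "s \<in> {1, -1}" and "[D = 2 * r] (mod 6)"
  shows "(r = s \<longrightarrow> [p_i = s] (mod 6) \<and> [p_f = -s] (mod 6)) \<and>
         (r = 2 * s \<longrightarrow> [p_i = -s] (mod 6) \<and> [p_f = s] (mod 6))"
proof -
  have "p_i = 3 * (2 * a - 1) - D" "p_f = 3 * (2 * a - 1) + D" "s = 1 \<or> s = -1"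
    using assms by (auto simp: class_II_def)
  then show ?thesis using assms(3) unfolding cong_iff_dvd_diff
    by (intro conjI impI; presburger)
qed

lemma class_I_residues:
  assumes "class_I p_i p_f D a" and "r \<in> {0, 1, -1}" and "a0 \<in> {0, 1, -1}"
    and D: "[D = 1 + 2 * r] (mod 6)" and a: "[a = a0] (mod 3)"
  shows "[p_i = -1 - 2 * r + 2 * a0] (mod 6) \<and>
         [p_f = 1 + 2 * r + 2 * a0] (mod 6) \<and>
         (r \<in> {0, -1} \<longleftrightarrow> [D = 1] (mod 6) \<or> [D = -1] (mod 6)) \<and>
         (r \<in> {0, -1} \<and> p_i \<noteq> 3 \<longrightarrow> a0 = 0) \<and>
         (r = 1 \<longleftrightarrow> [D = 3] (mod 6)) \<and>
         (r = 1 \<longrightarrow> \<not> [a = 0] (mod 3))"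
proof -
  have pair: "odd_prime_pair p_i p_f D" and eq: "p_i = 2 * a - D" "p_f = 2 * a + D"
    using assms(1) by (auto simp: class_I_def)
  note three = odd_prime_pair_3_dvd[OF pair]
  have r: "r = 0 \<or> r = 1 \<or> r = -1" and a0: "a0 = 0 \<or> a0 = 1 \<or> a0 = -1"
    using assms(2,3) by auto
  note dvds = D[unfolded cong_iff_dvd_diff] a[unfolded cong_iff_dvd_diff]
  have "6 dvd p_i - (-1 - 2 * r + 2 * a0)" "6 dvd p_f - (1 + 2 * r + 2 * a0)"
    using eq dvds by presburger+
  \<comment> \<open>For \<open>r\<close> equal to 0, 1, -1 the values \<open>1 + 2 * r\<close> are
    1, 3, -1, distinct modulo 6, so the residue of \<open>D\<close> determines
    \<open>r\<close>.\<close>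
  moreover have "r = 0 \<or> r = -1 \<longleftrightarrow> 6 dvd D - 1 \<or> 6 dvd D - (-1)"
    using dvds(1) r by presburger
  moreover have "r = 1 \<longleftrightarrow> 6 dvd D - 3"
    using dvds(1) r by presburger
  moreover have "a0 = 0" if "r = 0 \<or> r = -1" "p_i \<noteq> 3"
  proof -
    \<comment> \<open>Here \<open>D\<close> is 1 or -1 modulo 3. As \<open>2 * a\<close> avoids both
      \<open>D\<close> and \<open>-D\<close> modulo 3, only 0 is left for it, and hence for
      \<open>a\<close>.\<close>
    have "\<not> 3 dvd 2 * a - D" "\<not> 3 dvd 2 * a + D"
      using that(2) three eq by auto
    then show ?thesis using that(1) a0 dvds by presburger
  qed
  \<comment> \<open>Now 3 divides \<open>D\<close>, so 3 dividing \<open>a\<close> would make it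
    divide \<open>p_f\<close>; arguing with \<open>p_f\<close> also covers
    \<open>p_i = 3\<close>.\<close>
  moreover have "\<not> 3 dvd a" if "r = 1"
    using three(2) eq(2) dvds(1) that by presburger
  ultimately show ?thesis unfolding cong_iff_dvd_diff by simp
qed

theorem theorem2p3:
  fixes p_i p_f D a :: int
  shows
    "(class_III p_i p_f D a \<longrightarrow>
        [D = 0] (mod 6) \<and> [p_i = p_f] (mod 6) \<and> [p_f = 2 * a + 1] (mod 6) \<and>
        ([a = 0] (mod 3) \<longrightarrow> [p_i = 1] (mod 6) \<and> [p_f = 1] (mod 6)) \<and>
        ([a = -1] (mod 3) \<longrightarrow> [p_i = -1] (mod 6) \<and> [p_f = -1] (mod 6)))
   \<and> (class_II p_i p_f D a \<longrightarrow>
        (\<forall>r s :: int. s \<in> {1, -1} \<and> [D = 2 * r] (mod 6) \<longrightarrow>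
           (r = s \<longrightarrow> [p_i = s] (mod 6) \<and> [p_f = -s] (mod 6)) \<and>
           (r = 2 * s \<longrightarrow> [p_i = -s] (mod 6) \<and> [p_f = s] (mod 6))))
   \<and> (class_I p_i p_f D a \<longrightarrow>
        (\<forall>r a0 :: int. r \<in> {0, 1, -1} \<and> a0 \<in> {0, 1, -1} \<and>
           [D = 1 + 2 * r] (mod 6) \<and> [a = a0] (mod 3) \<longrightarrow>
           [p_i = -1 - 2 * r + 2 * a0] (mod 6) \<and>
           [p_f = 1 + 2 * r + 2 * a0] (mod 6) \<and>
           (r \<in> {0, -1} \<longleftrightarrow> [D = 1] (mod 6) \<or> [D = -1] (mod 6)) \<and>
           (r \<in> {0, -1} \<and> p_i \<noteq> 3 \<longrightarrow> a0 = 0) \<and>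
           (r = 1 \<longleftrightarrow> [D = 3] (mod 6)) \<and>
           (r = 1 \<longrightarrow> \<not> [a = 0] (mod 3))))"
  using class_III_residues class_II_residues class_I_residues by blast

end
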